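(* Let $f$ satisfy $(\mathcal A)$, let $t_0>0$, $q\ge\frac12$, $p\ge1$. Let $y:[t_0,+\infty[\to\mathcal H$ be continuously differentiable and $\lambda:[t_0,+\infty[\to\,]0,+\infty[$ continuous such that, with $\tau(t)=\frac{1}{q^q}\big(t_0+\int_{t_0}^t[\lambda(r)]^{1/q}dr\big)^q$, for all $t\ge t_0$: $$\dot y(t)+\dot\tau(t)\nabla f(y(t))=0,\qquad [\lambda(t)]^p\|\nabla f(y(t))\|^{p-1}=1 .$$ Then, as $t\to+\infty$: (i) $f(y(t))-\inf_{\mathcal H}f=o(t^{-pq})$; (ii) $\|\nabla f(y(t))\|=o(t^{-pq})$; (iii) $\int_{t_0}^{+\infty}t^{pq(2-\frac1q)}\|\nabla f(y(t))\|^{2+\frac{p-1}{pq}}\,dt<+\infty$; (iv) $y(t)$ converges weakly as $t\to+\infty$ to an element of $S=\operatorname{argmin} f$.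
   Context: $\mathcal H$ is a real Hilbert space. Assumption $(\mathcal A)$: $f:\mathcal H\to\mathbb R$ is convex and continuously differentiable, $S=\operatorname{argmin}_{\mathcal H} f\neq\emptyset$, and $\nabla f$ is Lipschitz continuous on bounded subsets of $\mathcal H$. *)

theory Defs
  imports "HOL-Analysis.Analysis" "HOL-Library.Landau_Symbols"
begin

definition weakly_converges_at_top :: "(real \<Rightarrow> 'a::real_inner) \<Rightarrow> 'a \<Rightarrow> bool" where
  "weakly_converges_at_top y x \<longleftrightarrow> (\<forall>v. ((\<lambda>t. inner (y t) v) \<longlongrightarrow> inner x v) at_top)"

text \<open>Real power with the usual convention 0 to the power 0 equals 1.\<close>
definition rpow :: "real \<Rightarrow> real \<Rightarrow> real" where
  "rpow x a = (if a = 0 then 1 else x powr a)"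

end

theory Submission
  imports Defs
begin

text \<open>
  Write \<open>g = \<nabla>f(y)\<close>. In the time scale \<open>\<tau>\<close> the curve \<open>y\<close> is a steepest descent trajectory, so \<open>norm g\<close>
  is nonincreasing, and the Lyapunov function \<open>\<tau> (f(y) - min f) + (norm (y - z))\<^sup>2 / 2\<close> yields
  \<open>\<integral> \<tau> \<tau>' (norm g)\<^sup>2 < \<infinity>\<close>. Together these give \<open>norm g = o(1/\<tau>)\<close>, hence \<open>f(y) - min f = o(1/\<tau>)\<close>.
  With \<open>\<tau> = c \<theta>\<^sup>q\<close>, the closed-loop law turns \<open>norm g = O(1/\<tau>)\<close> into the differential inequality
  \<open>\<theta>' \<ge> b \<theta> powr (1 - 1/p)\<close>, so that \<open>\<tau>\<close> grows at least like \<open>t powr (p q)\<close>. Weak convergence is Opial's argument.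
\<close>

section \<open>Nested closed convex sets and weak convergence\<close>

text \<open>Points of nearly minimal norm in \<open>C n\<close> form a Cauchy sequence: their norms
  and the distances \<open>d n\<close> share one limit, and the parallelogram law does the rest. Its
  limit is the common point. This stands in for weak compactness of bounded closed convex
  sets.\<close>

lemma nested_closed_convex_Inter_nonempty:
  fixes C :: "nat \<Rightarrow> 'a::{real_inner, complete_space} set"
  assumes closed: "\<And>n. closed (C n)" and convex: "\<And>n. convex (C n)"
    and nonempty: "\<And>n. C n \<noteq> {}" and bounded: "bounded (C 0)" and decseq: "decseq C"
  shows "(\<Inter>n. C n) \<noteq> {}"
proof -
  define d where "d n = infdist 0 (C n)" for n
  obtain B where B: "\<And>x. x \<in> C 0 \<Longrightarrow> norm x \<le> B"
    using bounded by (auto simp: bounded_iff)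
  have sub: "C m \<subseteq> C n" if "n \<le> m" for m n
    using decseqD[OF decseq that] by simp
  have d_le: "d n \<le> norm x" if "x \<in> C n" for n x
    using infdist_le[OF that, of 0] by (simp add: d_def)
  have "incseq d"
    unfolding d_def by (intro incseq_SucI infdist_mono sub nonempty) auto
  moreover have "d n \<le> B" for n
  proof -
    obtain x where "x \<in> C n" using nonempty[of n] by blast
    then show ?thesis using d_le[of x n] B[of x] sub[of 0 n] by force
  qed
  ultimately have d_lim: "d \<longlonglongrightarrow> (SUP n. d n)"
    by (intro LIMSEQ_incseq_SUP bdd_aboveI[of _ B]) auto
  have "\<exists>c\<in>C n. norm c < d n + 1 / Suc n" for n
  proof (rule ccontr)
    assume "\<not> ?thesis"
    then have "d n + 1 / Suc n \<le> infdist 0 (C n)"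
      unfolding infdist_def using nonempty[of n] by (auto intro!: cINF_greatest simp: not_less)
    then show False by (simp add: d_def)
  qed
  then obtain c where c: "\<And>n. c n \<in> C n" "\<And>n. norm (c n) < d n + 1 / Suc n" by metis
  have "(\<lambda>n. d n + 1 / Suc n) \<longlonglongrightarrow> (SUP n. d n)"
    using tendsto_add[OF d_lim LIMSEQ_Suc[OF lim_1_over_n]] by simp
  then have c_lim: "(\<lambda>n. norm (c n)) \<longlonglongrightarrow> (SUP n. d n)"
    by (rule tendsto_sandwich[rotated 3])
      (rule always_eventually allI d_le c(1) d_lim less_imp_le[OF c(2)])+
  \<comment> \<open>The midpoint of \<open>c m\<close> and \<open>c n\<close> still lies in \<open>C n\<close>, so the parallelogram law controls their distance.\<close>
  have para: "(norm (c m - c n))\<^sup>2 \<le> 2 * (norm (c m))\<^sup>2 + 2 * (norm (c n))\<^sup>2 - 4 * (d n)\<^sup>2" if "n \<le> m" for m n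
  proof -
    have "(1/2) *\<^sub>R c m + (1/2) *\<^sub>R c n \<in> C n"
      using c(1)[of m] c(1)[of n] sub[OF that] by (intro convexD[OF convex]) auto
    from d_le[OF this] have "2 * d n \<le> norm (c m + c n)"
      by (simp flip: scaleR_add_right)
    moreover have "0 \<le> d n" by (simp add: d_def infdist_nonneg)
    ultimately have "(2 * d n)\<^sup>2 \<le> (norm (c m + c n))\<^sup>2"
      by (intro power_mono) auto
    then show ?thesis
      unfolding power2_norm_eq_inner by (simp add: algebra_simps inner_commute power2_eq_square)
  qed
  have "Cauchy c"
  proof (rule CauchyI')
    fix e :: real assume "0 < e"
    define D where "D = (SUP n. d n)"
    have "(\<lambda>n. (norm (c n))\<^sup>2) \<longlonglongrightarrow> D\<^sup>2" "(\<lambda>n. (d n)\<^sup>2) \<longlonglongrightarrow> D\<^sup>2"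
      unfolding D_def by (intro tendsto_power c_lim d_lim)+
    \<comment> \<open>In \<open>para\<close> the coefficients 2, 2 and 4 add up to 8 and the
      \<open>D\<^sup>2\<close> terms cancel, so an error below \<open>e\<^sup>2 / 8\<close> in each
      square yields a bound below \<open>e\<^sup>2\<close>.\<close>
    then have "\<forall>\<^sub>F n in sequentially. dist ((norm (c n))\<^sup>2) (D\<^sup>2) < e\<^sup>2 / 8 \<and> dist ((d n)\<^sup>2) (D\<^sup>2) < e\<^sup>2 / 8"
      using \<open>0 < e\<close> by (intro eventually_conj tendstoD) auto
    then obtain N where N: "\<And>n. N \<le> n \<Longrightarrow> dist ((norm (c n))\<^sup>2) (D\<^sup>2) < e\<^sup>2 / 8 \<and> dist ((d n)\<^sup>2) (D\<^sup>2) < e\<^sup>2 / 8"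
      by (auto simp: eventually_sequentially)
    have "dist (c m) (c n) < e" if "N \<le> m" "m < n" for m n
    proof -
      have "(norm (c n - c m))\<^sup>2 < e\<^sup>2"
        using para[of m n] conjunct1[OF N[of m]] conjunct2[OF N[of m]] conjunct1[OF N[of n]] that
        unfolding dist_real_def by linarith
      then show ?thesis
        using \<open>0 < e\<close> power_less_imp_less_base[of "norm (c n - c m)" 2 e] by (simp add: dist_norm norm_minus_commute)
    qed
    then show "\<exists>M. \<forall>m\<ge>M. \<forall>n>m. dist (c m) (c n) < e" by blast
  qed
  then obtain w where w: "c \<longlonglongrightarrow> w"
    using Cauchy_convergent convergent_def by blast
  have "w \<in> C n" for n
  proof (rule Lim_in_closed_set[OF closed _ _ w])
    show "\<forall>\<^sub>F m in sequentially. c m \<in> C n"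
      using c(1) sub by (intro eventually_sequentiallyI[of n]) blast
  qed simp
  then show ?thesis by blast
qed

text \<open>A substitute for a weak cluster point along the times satisfying \<open>P\<close>. The
  point \<open>w\<close> lies in the closed convex hulls of all tails, which are nonempty because
  \<open>P\<close> recurs; a closed convex set that eventually holds the values contains one of
  these hulls.\<close>

lemma frequently_closed_convex_cluster_point:
  fixes y :: "real \<Rightarrow> 'a::{real_inner, complete_space}"
  assumes bounded: "bounded (y ` {a..})" and freq: "frequently P at_top"
  obtains w where
    "\<And>C. closed C \<Longrightarrow> convex C \<Longrightarrow> (\<forall>\<^sub>F t in at_top. P t \<longrightarrow> y t \<in> C) \<Longrightarrow> w \<in> C"
proof -
  define A where "A n = y ` {t. a + real n \<le> t \<and> P t}" for n
  define C where "C n = closure (convex hull (A n))" for n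
  have "(\<Inter>n. C n) \<noteq> {}"
  proof (rule nested_closed_convex_Inter_nonempty)
    show "C n \<noteq> {}" for n
    proof -
      obtain t where "a + real n \<le> t" "P t"
        using frequently_eventually_frequently[OF freq eventually_ge_at_top[of "a + real n"]]
        by (auto dest: frequently_ex)
      then show ?thesis by (auto simp: C_def A_def)
    qed
    show "bounded (C 0)"
      unfolding C_def A_def by (intro bounded_closure bounded_convex_hull bounded_subset[OF bounded]) auto
    show "decseq C"
      unfolding C_def A_def by (intro decseq_SucI closure_mono hull_mono image_mono) auto
  qed (auto simp: C_def)
  then obtain w where w: "\<And>n. w \<in> C n" by blast
  show thesis
  proof (rule that)
    fix K :: "'a set" assume K: "closed K" "convex K" "\<forall>\<^sub>F t in at_top. P t \<longrightarrow> y t \<in> K"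
    then obtain T where T: "\<And>t. T \<le> t \<Longrightarrow> P t \<Longrightarrow> y t \<in> K" by (auto simp: eventually_at_top_linorder)
    obtain n where "T - a \<le> real n" using real_arch_simple by blast
    then have "A n \<subseteq> K" using T by (auto simp: A_def)
    then have "C n \<subseteq> K" unfolding C_def using K by (intro closure_minimal hull_minimal) auto
    then show "w \<in> K" using w by blast
  qed
qed

text \<open>A variant of Opial's lemma. Nested closed convex hulls replace weak sequential compactness.\<close>
lemma weakly_converges_to_minimizer:
  fixes f :: "'a::{real_inner, complete_space} \<Rightarrow> real"
  assumes convex: "convex_on UNIV f" and cont: "continuous_on UNIV f"
    and bounded: "bounded (y ` {a..})"
    and lim_norm: "\<And>z. \<forall>x. f z \<le> f x \<Longrightarrow> \<exists>l. ((\<lambda>t. norm (y t - z)) \<longlongrightarrow> l) at_top"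
    and z0: "\<forall>x. f z0 \<le> f x" and lim_f: "((\<lambda>t. f (y t)) \<longlongrightarrow> f z0) at_top"
  shows "\<exists>x\<in>{x. \<forall>z. f x \<le> f z}. weakly_converges_at_top y x"
proof -
  \<comment> \<open>\<open>P\<close> plays the part of a subsequence: it selects the times that
    \<open>w\<close> has to reflect. The test sets \<open>C\<close> used below are sublevel sets of
    \<open>f\<close>, slabs and half-spaces.\<close>
  define cluster where "cluster P w \<longleftrightarrow>
    (\<forall>C. closed C \<longrightarrow> convex C \<longrightarrow> (\<forall>\<^sub>F t in at_top. P t \<longrightarrow> y t \<in> C) \<longrightarrow> w \<in> C)" for P w
  have ex: "\<exists>w. cluster P w" if "frequently P at_top" for P
    by (rule frequently_closed_convex_cluster_point[OF bounded that]) (auto simp: cluster_def)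
  have mem: "w \<in> C" if "cluster P w" "closed C" "convex C" "\<forall>\<^sub>F t in at_top. P t \<longrightarrow> y t \<in> C" for P w C
    using that unfolding cluster_def by blast
  have argmin: "\<forall>x. f w \<le> f x" if "cluster P w" for P w
  proof -
    have "f w \<le> f z0 + e" if "0 < e" for e
    proof -
      have "w \<in> {x. f x \<le> f z0 + e}"
      proof (rule mem[OF \<open>cluster P w\<close>])
        show "closed {x. f x \<le> f z0 + e}"
          by (intro closed_Collect_le cont continuous_intros)
        show "convex {x. f x \<le> f z0 + e}"
        proof (rule convexI)
          fix x z :: 'a and u v :: real
          assume *: "x \<in> {x. f x \<le> f z0 + e}" "z \<in> {x. f x \<le> f z0 + e}" "0 \<le> u" "0 \<le> v" "u + v = 1"
          then have "f (u *\<^sub>R x + v *\<^sub>R z) \<le> max (f x) (f z)"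
            by (intro convex_lower[OF convex]) auto
          then show "u *\<^sub>R x + v *\<^sub>R z \<in> {x. f x \<le> f z0 + e}" using * by auto
        qed
        show "\<forall>\<^sub>F t in at_top. P t \<longrightarrow> y t \<in> {x. f x \<le> f z0 + e}"
          using order_tendstoD(2)[OF lim_f, of "f z0 + e"] that by (auto elim: eventually_mono)
      qed
      then show ?thesis by simp
    qed
    then have "f w \<le> f z0" by (rule field_le_epsilon)
    then show ?thesis using z0 by (blast intro: order_trans)
  qed
  \<comment> \<open>The difference of the squared distances to \<open>w\<close> and \<open>u\<close>
    is affine in \<open>y t\<close>, so convergence of both distances makes
    \<open>inner (u - w) (y t)\<close> converge to some \<open>k\<close>. Thin slabs around level
    \<open>k\<close> then put both points on that level.\<close>
  have unique: "u = w" if u: "cluster P u" and w: "cluster Q w" for P Q u w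
  proof -
    obtain l m where "((\<lambda>t. norm (y t - u)) \<longlongrightarrow> l) at_top" "((\<lambda>t. norm (y t - w)) \<longlongrightarrow> m) at_top"
      using lim_norm[OF argmin[OF u]] lim_norm[OF argmin[OF w]] by blast
    then have "((\<lambda>t. ((norm (y t - w))\<^sup>2 - (norm (y t - u))\<^sup>2 + (norm u)\<^sup>2 - (norm w)\<^sup>2) / 2)
        \<longlongrightarrow> (m\<^sup>2 - l\<^sup>2 + (norm u)\<^sup>2 - (norm w)\<^sup>2) / 2) at_top"
      by (intro tendsto_intros) auto
    moreover have "((norm (y t - w))\<^sup>2 - (norm (y t - u))\<^sup>2 + (norm u)\<^sup>2 - (norm w)\<^sup>2) / 2 = inner (u - w) (y t)" for t
      unfolding power2_norm_eq_inner by (simp add: field_simps inner_diff_left inner_diff_right inner_commute)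
    ultimately obtain k where k: "((\<lambda>t. inner (u - w) (y t)) \<longlongrightarrow> k) at_top" by auto
    have "inner (u - w) x = k" if "cluster R x" for R x
    proof -
      have "\<bar>inner (u - w) x - k\<bar> \<le> e" if "0 < e" for e
      proof -
        have ev: "\<forall>\<^sub>F t in at_top. \<bar>inner (u - w) (y t) - k\<bar> < e"
          using tendstoD[OF k that] by (simp add: dist_real_def)
        have "x \<in> {x. inner (u - w) x \<le> k + e} \<inter> {x. inner (u - w) x \<ge> k - e}"
          by (rule mem[OF \<open>cluster R x\<close>])
            (use ev in \<open>auto intro!: closed_Int closed_halfspace_le closed_halfspace_ge convex_Int
               convex_halfspace_le convex_halfspace_ge elim: eventually_mono\<close>)
        then show ?thesis by auto
      qed
      then have "\<bar>inner (u - w) x - k\<bar> \<le> 0" by (rule field_le_epsilon[of _ 0, simplified]) 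
      then show ?thesis by simp
    qed
    from this[OF u] this[OF w] have "inner (u - w) (u - w) = 0" by (simp add: inner_diff_right)
    then show ?thesis by simp
  qed
  obtain x where x: "cluster (\<lambda>_. True) x" using ex[of "\<lambda>_. True"] by auto
  \<comment> \<open>If the gap recurred, the times at which it occurs would have a cluster point of
    their own, separated from \<open>x\<close> by \<open>e\<close> in direction \<open>v\<close>,
    against \<open>unique\<close>. Taking \<open>v\<close> and \<open>- v\<close> gives the
    two-sided estimate below.\<close>
  have no_gap: "\<not> frequently (\<lambda>t. inner v x + e \<le> inner v (y t)) at_top" if "0 < e" for v e
  proof
    assume "frequently (\<lambda>t. inner v x + e \<le> inner v (y t)) at_top"
    then obtain w where w: "cluster (\<lambda>t. inner v x + e \<le> inner v (y t)) w" using ex by blast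
    have "w \<in> {z. inner v z \<ge> inner v x + e}"
      by (rule mem[OF w]) (auto intro: closed_halfspace_ge convex_halfspace_ge)
    then show False using unique[OF x w] that by simp
  qed
  have "((\<lambda>t. inner (y t) v) \<longlongrightarrow> inner x v) at_top" for v
  proof (rule tendstoI)
    fix e :: real assume "0 < e"
    have "\<forall>\<^sub>F t in at_top. inner v (y t) < inner v x + e" "\<forall>\<^sub>F t in at_top. inner (- v) (y t) < inner (- v) x + e"
      using no_gap[OF \<open>0 < e\<close>, of v] no_gap[OF \<open>0 < e\<close>, of "- v"] by (simp_all add: not_frequently not_le)
    then show "\<forall>\<^sub>F t in at_top. dist (inner (y t) v) (inner x v) < e"
      by eventually_elim (auto simp: dist_real_def inner_commute abs_less_iff)
  qed
  then show ?thesis using argmin[OF x] by (auto simp: weakly_converges_at_top_def)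
qed

section \<open>Convexity and calculus on a half-line\<close>

text \<open>Restriction to the line through \<open>x\<close> and \<open>z\<close> reduces this to
  the tangent inequality for a convex function of one real variable.\<close>

lemma convex_on_ge_tangent:
  fixes f :: "'a::real_inner \<Rightarrow> real"
  assumes convex: "convex_on UNIV f" and deriv: "(f has_derivative (\<lambda>h. inner g h)) (at x)"
  shows "f x + inner g (z - x) \<le> f z"
proof -
  define h where "h s = f (x + s *\<^sub>R (z - x))" for s :: real
  have "convex_on UNIV h"
  proof (rule convex_onI)
    fix t r s :: real assume t: "0 < t" "t < 1"
    have "x + ((1 - t) *\<^sub>R r + t *\<^sub>R s) *\<^sub>R (z - x)
        = (1 - t) *\<^sub>R (x + r *\<^sub>R (z - x)) + t *\<^sub>R (x + s *\<^sub>R (z - x))"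
      by (simp add: algebra_simps)
    then show "h ((1 - t) *\<^sub>R r + t *\<^sub>R s) \<le> (1 - t) * h r + t * h s"
      unfolding h_def using t convex_onD[OF convex, of t] by auto
  qed simp
  moreover have "(h has_field_derivative inner g (z - x)) (at 0)"
  proof -
    have "((\<lambda>s. x + s *\<^sub>R (z - x)) has_derivative (\<lambda>s. s *\<^sub>R (z - x))) (at (0::real))"
      by (auto intro!: derivative_eq_intros)
    then have "(h has_derivative (\<lambda>s. inner g (s *\<^sub>R (z - x)))) (at 0)"
      unfolding h_def using has_derivative_compose[where g = f and g' = "inner g"] deriv by fastforce
    then show ?thesis by (simp add: has_field_derivative_def mult_commute_abs)
  qed
  ultimately have "inner g (z - x) * (1 - 0) \<le> h 1 - h 0"
    by (intro convex_on_imp_above_tangent) auto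
  then show ?thesis by (simp add: h_def)
qed

text \<open>Monotone convergence for the truncations of \<open>g\<close> to
  \<open>{a..a + real k}\<close>, whose integrals are bounded by \<open>B\<close>.\<close>

lemma integrable_on_atLeast_of_bounded:
  fixes g :: "real \<Rightarrow> real"
  assumes cont: "continuous_on {a..} g" and nonneg: "\<And>t. a \<le> t \<Longrightarrow> 0 \<le> g t"
    and bound: "\<And>t. a \<le> t \<Longrightarrow> integral {a..t} g \<le> B"
  shows "g integrable_on {a..}"
proof -
  define h where "h k t = (if t \<in> {a..a + real k} then g t else 0)" for k t
  have eq: "{a..a + real k} \<inter> {a..} = {a..a + real k}" for k by auto
  have int: "g integrable_on {a..a + real k}" for k
    by (intro integrable_continuous_real continuous_on_subset[OF cont]) auto
  have "g integrable_on {a..} \<and> (\<lambda>k. integral {a..} (h k)) \<longlonglongrightarrow> integral {a..} g"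
  proof (rule monotone_convergence_increasing)
    show "h k integrable_on {a..}" for k
      using int[of k] integrable_restrict_Int[of "{a..a + real k}" g "{a..}"] by (simp add: h_def[abs_def] eq)
    show "h k t \<le> h (Suc k) t" if "t \<in> {a..}" for k t
      using nonneg that by (auto simp: h_def)
    show "(\<lambda>k. h k t) \<longlonglongrightarrow> g t" if "t \<in> {a..}" for t
    proof -
      obtain N where "t - a \<le> real N" using real_arch_simple by blast
      then have "\<forall>\<^sub>F k in sequentially. h k t = g t"
        using that by (intro eventually_sequentiallyI[of N]) (auto simp: h_def)
      then show ?thesis by (rule tendsto_eventually)
    qed
    have "integral {a..} (h k) = integral {a..a + real k} g" for k
      using integral_restrict_Int[of "{a..}" "{a..a + real k}" g] by (simp add: h_def[abs_def] eq Int_commute)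
    moreover have "0 \<le> integral {a..a + real k} g" for k
      using nonneg int by (intro integral_nonneg) auto
    ultimately have "norm (integral {a..} (h k)) \<le> B" for k using bound[of "a + real k"] by simp
    then show "bounded (range (\<lambda>k. integral {a..} (h k)))"
      by (auto simp: bounded_iff)
  qed
  then show ?thesis by blast
qed

lemma antimono_nonneg_tendsto_at_top:
  fixes F :: "real \<Rightarrow> real"
  assumes antimono: "\<And>s t. a \<le> s \<Longrightarrow> s \<le> t \<Longrightarrow> F t \<le> F s" and nonneg: "\<And>t. a \<le> t \<Longrightarrow> 0 \<le> F t"
  obtains l where "(F \<longlongrightarrow> l) at_top" "\<And>t. a \<le> t \<Longrightarrow> l \<le> F t"
proof -
  define l where "l = Inf (F ` {a..})"
  have bdd: "bdd_below (F ` {a..})" using nonneg by (intro bdd_belowI[of _ 0]) auto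
  have le: "l \<le> F t" if "a \<le> t" for t
    unfolding l_def using that bdd by (intro cInf_lower) auto
  have "(F \<longlongrightarrow> l) at_top"
  proof (rule tendstoI)
    fix e :: real assume "0 < e"
    then have "Inf (F ` {a..}) < l + e" by (simp add: l_def)
    then obtain s where s: "a \<le> s" "F s < l + e"
      by (subst (asm) cInf_less_iff) (use bdd in auto)
    have "dist (F t) l < e" if "s \<le> t" for t
      using antimono[of s t] le[of t] s that by (auto simp: dist_real_def)
    then show "\<forall>\<^sub>F t in at_top. dist (F t) l < e" by (auto simp: eventually_at_top_linorder)
  qed
  then show thesis using le that by blast
qed

lemma has_real_derivative_nonpos_imp_le:
  fixes F :: "real \<Rightarrow> real"
  assumes deriv: "\<And>r. a \<le> r \<Longrightarrow> (F has_real_derivative F' r) (at r within {a..})"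
    and nonpos: "\<And>r. s \<le> r \<Longrightarrow> r \<le> t \<Longrightarrow> F' r \<le> 0"
    and "a \<le> s" "s \<le> t"
  shows "F t \<le> F s"
proof (rule DERIV_nonpos_imp_decreasing_open[OF \<open>s \<le> t\<close>])
  show "\<exists>d. (F has_real_derivative d) (at x) \<and> d \<le> 0" if "s < x" "x < t" for x
    using deriv[of x] nonpos[of x] that \<open>a \<le> s\<close> at_within_interior[of x "{a..}"] by auto
  have "continuous_on {a..} F" using deriv by (auto intro!: DERIV_continuous_on)
  then show "continuous_on {s..t} F" by (rule continuous_on_subset) (use \<open>a \<le> s\<close> in auto)
qed

lemma integral_has_real_derivative_atLeast:
  fixes g :: "real \<Rightarrow> real"
  assumes cont: "continuous_on {a..} g" and "a \<le> t"
  shows "((\<lambda>u. integral {a..u} g) has_real_derivative g t) (at t within {a..})"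
proof -
  have "((\<lambda>u. integral {a..u} g) has_real_derivative g t) (at t within {a..t + 1})"
    using \<open>a \<le> t\<close> by (intro integral_has_real_derivative continuous_on_subset[OF cont]) auto
  moreover have "at t within {a..t + 1} = at t within {a..}"
    by (rule at_within_nhd[of t "{..<t + 1}"]) auto
  ultimately show ?thesis by simp
qed

text \<open>Replaces the sign of a derivative where \<open>F\<close> may fail to be differentiable,
  as for the squared gradient norm when \<open>gradf\<close> is only locally Lipschitz. Over equal
  pieces shorter than \<open>d\<close> the errors add up to at most \<open>e\<close>.\<close>

lemma le_if_uniformly_small_increments:
  fixes F :: "real \<Rightarrow> real"
  assumes "a \<le> b"
    and incr: "\<And>e. 0 < e \<Longrightarrow> \<exists>d>0. \<forall>s t. a \<le> s \<longrightarrow> s \<le> t \<longrightarrow> t \<le> b \<longrightarrow> t - s < d \<longrightarrow> F t \<le> F s + e * (t - s)"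
  shows "F b \<le> F a"
proof (rule field_le_epsilon)
  fix e :: real assume "0 < e"
  \<comment> \<open>The added 1 keeps the denominator positive when \<open>a = b\<close>.\<close>
  define e' where "e' = e / (b - a + 1)"
  have "0 < e'" using \<open>0 < e\<close> \<open>a \<le> b\<close> by (simp add: e'_def)
  from incr[OF this] obtain d where "0 < d"
    and d: "\<And>s t. a \<le> s \<Longrightarrow> s \<le> t \<Longrightarrow> t \<le> b \<Longrightarrow> t - s < d \<Longrightarrow> F t \<le> F s + e' * (t - s)" by blast
  obtain n where n: "(b - a) / d < real n" using reals_Archimedean2 by blast
  define \<delta> where "\<delta> = (b - a) / Suc n"
  have \<delta>: "0 \<le> \<delta>" "\<delta> < d" "Suc n * \<delta> = b - a"
    using n \<open>0 < d\<close> \<open>a \<le> b\<close> by (auto simp: \<delta>_def field_simps)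
  have "F (a + real i * \<delta>) \<le> F a + e' * (real i * \<delta>)" if "i \<le> Suc n" for i
    using that
  proof (induction i)
    case (Suc i)
    have "real (Suc i) * \<delta> \<le> Suc n * \<delta>" using Suc.prems \<delta>(1) by (intro mult_right_mono) auto
    then have "a + real (Suc i) * \<delta> \<le> b" using \<delta>(3) by linarith
    then have "F (a + real (Suc i) * \<delta>) \<le> F (a + real i * \<delta>) + e' * \<delta>"
      using d[of "a + real i * \<delta>" "a + real (Suc i) * \<delta>"] \<delta>(1,2) by (simp add: algebra_simps)
    then show ?case using Suc by (simp add: algebra_simps)
  qed simp
  from this[of "Suc n"] have "F b \<le> F a + e' * (b - a)" unfolding \<delta>(3) by simp
  also have "e' * (b - a) \<le> e' * (b - a + 1)" using \<open>0 < e'\<close> by simp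
  also have "\<dots> = e" using \<open>a \<le> b\<close> by (simp add: e'_def)
  finally show "F b \<le> F a + e" by simp
qed

section \<open>Steepest descent in the time scale \<open>\<tau>\<close>\<close>

text \<open>The closed-loop law stays outside. So does divergence of \<open>\<tau>\<close>: in the
  application it is deduced from \<open>tau_norm_grad_bounded\<close>, and only the lemmas on limits
  assume it.\<close>

locale rescaled_gradient_flow =
  fixes f :: "'a::{real_inner, complete_space} \<Rightarrow> real" and gradf :: "'a \<Rightarrow> 'a"
    and y :: "real \<Rightarrow> 'a" and \<tau> \<tau>' :: "real \<Rightarrow> real" and a :: real
  assumes convex: "convex_on UNIV f"
    and grad: "\<And>x. (f has_derivative (\<lambda>h. inner (gradf x) h)) (at x)"
    and grad_cont: "continuous_on UNIV gradf"
    and grad_lip: "\<And>B. bounded B \<Longrightarrow> \<exists>L. L-lipschitz_on B gradf"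
    and y_deriv: "\<And>t. a \<le> t \<Longrightarrow> (y has_vector_derivative - \<tau>' t *\<^sub>R gradf (y t)) (at t within {a..})"
    and tau_deriv: "\<And>t. a \<le> t \<Longrightarrow> (\<tau> has_real_derivative \<tau>' t) (at t within {a..})"
    and tau'_cont: "continuous_on {a..} \<tau>'"
    and tau'_pos: "\<And>t. a \<le> t \<Longrightarrow> 0 < \<tau>' t"
    and tau_pos: "\<And>t. a \<le> t \<Longrightarrow> 0 < \<tau> t"
begin

lemma y_cont: "continuous_on {a..} y"
  by (rule continuous_on_vector_derivative[OF y_deriv]) simp

lemma tau_cont: "continuous_on {a..} \<tau>"
  using tau_deriv by (auto intro!: DERIV_continuous_on)

lemma grad_y_cont: "continuous_on {a..} (\<lambda>t. gradf (y t))"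
  using continuous_on_compose2[OF grad_cont y_cont] by simp

lemma f_y_deriv:
  assumes "a \<le> t"
  shows "((\<lambda>t. f (y t)) has_real_derivative - \<tau>' t * (norm (gradf (y t)))\<^sup>2) (at t within {a..})"
proof -
  have "((\<lambda>t. f (y t)) has_derivative (\<lambda>h. inner (gradf (y t)) (h *\<^sub>R (- \<tau>' t *\<^sub>R gradf (y t))))) (at t within {a..})"
    by (rule has_derivative_compose[OF y_deriv[OF assms, unfolded has_vector_derivative_def] grad])
  moreover have "(\<lambda>h. inner (gradf (y t)) (h *\<^sub>R (- \<tau>' t *\<^sub>R gradf (y t)))) = (*) (- \<tau>' t * (norm (gradf (y t)))\<^sup>2)"
    by (auto simp: power2_norm_eq_inner)
  ultimately show ?thesis by (simp add: has_field_derivative_def)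
qed

lemma dist_deriv:
  assumes "a \<le> t"
  shows "((\<lambda>t. (norm (y t - z))\<^sup>2 / 2) has_real_derivative - \<tau>' t * inner (gradf (y t)) (y t - z)) (at t within {a..})"
proof -
  have "((\<lambda>t. inner (y t - z) (y t - z)) has_derivative
      (\<lambda>h. 2 * inner (y t - z) (h *\<^sub>R (- \<tau>' t *\<^sub>R gradf (y t))))) (at t within {a..})"
    by (rule derivative_eq_intros y_deriv[OF assms, unfolded has_vector_derivative_def] refl)+ (auto simp: inner_commute)
  then have "((\<lambda>t. inner (y t - z) (y t - z)) has_real_derivative 2 * (- \<tau>' t * inner (gradf (y t)) (y t - z))) (at t within {a..})"
    by (rule has_derivative_imp_has_field_derivative) (auto simp: inner_commute)
  from DERIV_cdivide[OF this, of 2] show ?thesis by (simp add: power2_norm_eq_inner)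
qed

lemma tangent_le: "f x - f z \<le> inner (gradf x) (x - z)"
  using convex_on_ge_tangent[OF convex grad, of x z] by (simp add: inner_diff_right)

lemma inner_grad_diff_nonneg: "0 \<le> inner (gradf x - gradf z) (x - z)"
  using tangent_le[of x z] tangent_le[of z x] by (simp add: inner_diff_left inner_diff_right)

lemma tau_strict_mono:
  assumes "a \<le> s" "s < t"
  shows "\<tau> s < \<tau> t"
proof (rule DERIV_pos_imp_increasing_open[OF \<open>s < t\<close>])
  show "\<exists>d. (\<tau> has_real_derivative d) (at x) \<and> 0 < d" if "s < x" "x < t" for x
    using tau_deriv[of x] tau'_pos[of x] that \<open>a \<le> s\<close> at_within_interior[of x "{a..}"] by auto
  show "continuous_on {s..t} \<tau>"
    by (rule continuous_on_subset[OF tau_cont]) (use \<open>a \<le> s\<close> in auto)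
qed

text \<open>The curve \<open>y + \<tau> *\<^sub>R v\<close> has speed at most
  \<open>e * \<tau>'\<close>, so the mean value inequality compares it with
  \<open>e * \<tau>\<close>. Thus \<open>y\<close> moves with velocity nearly \<open>- v\<close> in
  the time scale \<open>\<tau>\<close>.\<close>

lemma norm_increment_le:
  assumes "a \<le> s" "s < t" and bound: "\<And>r. s \<le> r \<Longrightarrow> r \<le> t \<Longrightarrow> norm (gradf (y r) - v) \<le> e"
  shows "norm (y t - y s + (\<tau> t - \<tau> s) *\<^sub>R v) \<le> e * (\<tau> t - \<tau> s)"
proof -
  have "norm ((y t + \<tau> t *\<^sub>R v) - (y s + \<tau> s *\<^sub>R v)) \<le> e * \<tau> t - e * \<tau> s"
  proof (rule differentiable_bound_general[OF \<open>s < t\<close>, of _ _ "\<lambda>r. - \<tau>' r *\<^sub>R gradf (y r) + \<tau>' r *\<^sub>R v" "\<lambda>r. e * \<tau>' r"])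
    have sub: "{s..t} \<subseteq> {a..}" using \<open>a \<le> s\<close> by auto
    show "continuous_on {s..t} (\<lambda>t. y t + \<tau> t *\<^sub>R v)" "continuous_on {s..t} (\<lambda>t. e * \<tau> t)"
      by (intro continuous_intros continuous_on_subset[OF y_cont sub] continuous_on_subset[OF tau_cont sub])+
    fix r assume r: "s < r" "r < t"
    then have within: "at r within {a..} = at r" using \<open>a \<le> s\<close> by (intro at_within_interior) auto
    have \<tau>: "(\<tau> has_real_derivative \<tau>' r) (at r)" using tau_deriv[of r] r \<open>a \<le> s\<close> within by auto
    have y: "(y has_vector_derivative - \<tau>' r *\<^sub>R gradf (y r)) (at r)"
      using y_deriv[of r] r \<open>a \<le> s\<close> within by auto
    show "((\<lambda>t. y t + \<tau> t *\<^sub>R v) has_vector_derivative - \<tau>' r *\<^sub>R gradf (y r) + \<tau>' r *\<^sub>R v) (at r)"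
      by (intro has_vector_derivative_add[OF y] has_vector_derivative_real_field)
        (use \<tau> in \<open>auto intro!: derivative_eq_intros simp: has_real_derivative_iff_has_vector_derivative\<close>)
    show "((\<lambda>t. e * \<tau> t) has_vector_derivative e * \<tau>' r) (at r)"
      using \<tau> by (auto intro!: derivative_eq_intros simp flip: has_real_derivative_iff_has_vector_derivative)
    have "norm (- \<tau>' r *\<^sub>R gradf (y r) + \<tau>' r *\<^sub>R v) = \<tau>' r * norm (gradf (y r) - v)"
      using tau'_pos[of r] r \<open>a \<le> s\<close>
      by (simp add: norm_minus_commute flip: scaleR_diff_right)
    also have "\<dots> \<le> e * \<tau>' r"
      using bound[of r] tau'_pos[of r] r \<open>a \<le> s\<close> by (simp add: mult.commute)
    finally show "norm (- \<tau>' r *\<^sub>R gradf (y r) + \<tau>' r *\<^sub>R v) \<le> e * \<tau>' r" .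
  qed
  then show ?thesis by (simp add: algebra_simps)
qed

text \<open>Over a short interval \<open>y t - y s\<close> is nearly \<open>- (\<tau> t - \<tau> s) / 2 *\<^sub>R (g s + g t)\<close>,
  so monotonicity of the gradient bounds \<open>(norm (g t))\<^sup>2 - (norm (g s))\<^sup>2\<close> up to an error which,
  by the Lipschitz condition, is \<open>o(t - s)\<close>.\<close>
lemma norm_grad_antimono:
  assumes "a \<le> s" "s \<le> t"
  shows "norm (gradf (y t)) \<le> norm (gradf (y s))"
proof -
  define g where "g t = gradf (y t)" for t
  have sub: "{s..t} \<subseteq> {a..}" using \<open>a \<le> s\<close> by auto
  have g_cont: "continuous_on {s..t} g" unfolding g_def by (rule continuous_on_subset[OF grad_y_cont sub])
  have "compact (y ` {s..t})" by (intro compact_continuous_image continuous_on_subset[OF y_cont sub]) auto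
  then obtain L where L: "L-lipschitz_on (y ` {s..t}) gradf" using grad_lip compact_imp_bounded by blast
  have "compact ((\<lambda>r. - \<tau>' r *\<^sub>R g r) ` {s..t})"
    by (intro compact_continuous_image continuous_intros continuous_on_subset[OF tau'_cont sub] g_cont) auto
  then obtain M where M: "0 < M" "\<And>r. r \<in> {s..t} \<Longrightarrow> norm (- \<tau>' r *\<^sub>R g r) \<le> M"
    using compact_imp_bounded bounded_pos by (metis (no_types, lifting) image_eqI)
  have y_lip: "norm (y v - y u) \<le> M * (v - u)" if "s \<le> u" "u \<le> v" "v \<le> t" for u v
  proof (cases "u = v")
    case False
    have sub': "{u..v} \<subseteq> {a..}" using that \<open>a \<le> s\<close> by auto
    have "norm (y v - y u) \<le> M * v - M * u"
    proof (rule differentiable_bound_general[of u v _ _ "\<lambda>r. - \<tau>' r *\<^sub>R gradf (y r)" "\<lambda>_. M"])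
      fix r assume r: "u < r" "r < v"
      then have "at r within {a..} = at r" using that \<open>a \<le> s\<close> by (intro at_within_interior) auto
      then show "(y has_vector_derivative - \<tau>' r *\<^sub>R gradf (y r)) (at r)"
        using y_deriv[of r] r that \<open>a \<le> s\<close> by auto
      show "norm (- \<tau>' r *\<^sub>R gradf (y r)) \<le> M" using M(2)[of r] r that by (simp add: g_def)
      show "((*) M has_vector_derivative M) (at r)"
        by (auto intro!: derivative_eq_intros simp flip: has_real_derivative_iff_has_vector_derivative)
    qed (use False that continuous_on_subset[OF y_cont sub'] in \<open>auto intro!: continuous_intros\<close>)
    then show ?thesis by (simp add: algebra_simps)
  qed simp
  have L0: "0 \<le> L" using L by (rule lipschitz_on_nonneg)
  have g_lip: "norm (g v - g u) \<le> L * M * (v - u)" if "s \<le> u" "u \<le> v" "v \<le> t" for u v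
  proof -
    have "norm (g v - g u) \<le> L * norm (y v - y u)"
      using lipschitz_onD[OF L, of "y v" "y u"] that by (auto simp: g_def dist_norm)
    also have "\<dots> \<le> L * (M * (v - u))" using y_lip[OF that] L0 by (intro mult_left_mono)
    finally show ?thesis by simp
  qed
  have "(norm (g t))\<^sup>2 \<le> (norm (g s))\<^sup>2"
  proof (rule le_if_uniformly_small_increments[OF \<open>s \<le> t\<close>])
    fix e :: real assume "0 < e"
    \<comment> \<open>Chosen so that the final error factor \<open>2 * e' * (L * M + 1)\<close>
      equals \<open>e\<close>; the 1 avoids division by zero.\<close>
    define e' where "e' = e / (2 * (L * M + 1))"
    have LM: "0 \<le> L * M" using L0 M(1) by simp
    have "0 < e'" using \<open>0 < e\<close> LM by (simp add: e'_def)
    have "uniformly_continuous_on {s..t} g" by (rule compact_uniformly_continuous[OF g_cont]) simp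
    with \<open>0 < e'\<close> obtain d where "0 < d"
      and d: "\<And>u v. u \<in> {s..t} \<Longrightarrow> v \<in> {s..t} \<Longrightarrow> dist u v < d \<Longrightarrow> dist (g u) (g v) < e'"
      unfolding uniformly_continuous_on_def by metis
    have "(norm (g v))\<^sup>2 \<le> (norm (g u))\<^sup>2 + e * (v - u)" if uv: "s \<le> u" "u \<le> v" "v \<le> t" "v - u < d" for u v
    proof (cases "u = v")
      case False
      with uv have "u < v" by simp
      define \<Delta> where "\<Delta> = \<tau> v - \<tau> u"
      have "0 < \<Delta>" using tau_strict_mono[of u v] uv \<open>a \<le> s\<close> \<open>u < v\<close> by (simp add: \<Delta>_def)
      \<comment> \<open>Freezing the gradient at any \<open>w\<close> in the piece costs at most
        \<open>e' * \<Delta>\<close>. The choices \<open>w = u\<close> and \<open>w = v\<close>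
        together give the trapezoidal estimate \<open>err\<close>.\<close>
      have near: "norm (y v - y u + \<Delta> *\<^sub>R g w) \<le> e' * \<Delta>" if "w \<in> {u..v}" for w
        unfolding \<Delta>_def
      proof (rule norm_increment_le)
        show "norm (gradf (y r) - g w) \<le> e'" if "u \<le> r" "r \<le> v" for r
          using d[of r w] uv that \<open>w \<in> {u..v}\<close> by (force simp: g_def dist_norm abs_less_iff)
      qed (use uv \<open>a \<le> s\<close> \<open>u < v\<close> in auto)
      have "norm (2 *\<^sub>R (y v - y u) + \<Delta> *\<^sub>R (g u + g v)) \<le> norm (y v - y u + \<Delta> *\<^sub>R g u) + norm (y v - y u + \<Delta> *\<^sub>R g v)"
        using norm_triangle_ineq[of "y v - y u + \<Delta> *\<^sub>R g u" "y v - y u + \<Delta> *\<^sub>R g v"]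
        by (simp add: algebra_simps scaleR_2)
      also have "\<dots> \<le> 2 * e' * \<Delta>" using near[of u] near[of v] uv by auto
      finally have err: "norm (2 *\<^sub>R (y v - y u) + \<Delta> *\<^sub>R (g u + g v)) \<le> 2 * e' * \<Delta>" .
      \<comment> \<open>The difference of squares is \<open>inner (g v - g u) (g u + g v)\<close>.
        The trapezoidal error brings in \<open>y v - y u\<close>, and the correction has a
        favourable sign because the gradient is monotone.\<close>
      have "\<Delta> * ((norm (g v))\<^sup>2 - (norm (g u))\<^sup>2)
          = inner (g v - g u) (2 *\<^sub>R (y v - y u) + \<Delta> *\<^sub>R (g u + g v)) - 2 * inner (g v - g u) (y v - y u)"
        by (simp add: power2_norm_eq_inner algebra_simps inner_commute)
      also have "\<dots> \<le> inner (g v - g u) (2 *\<^sub>R (y v - y u) + \<Delta> *\<^sub>R (g u + g v))"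
        using inner_grad_diff_nonneg[of "y v" "y u"] by (simp add: g_def)
      also have "\<dots> \<le> norm (g v - g u) * norm (2 *\<^sub>R (y v - y u) + \<Delta> *\<^sub>R (g u + g v))"
        by (rule norm_cauchy_schwarz)
      \<comment> \<open>The first factor is of order \<open>v - u\<close>, the second of order
        \<open>e' * \<Delta>\<close>. Dividing by \<open>\<Delta>\<close> leaves an increment that
        is small relative to \<open>v - u\<close>.\<close>
      also have "\<dots> \<le> (L * M * (v - u)) * (2 * e' * \<Delta>)"
        using g_lip[of u v] err uv LM by (intro mult_mono) auto
      also have "\<dots> = \<Delta> * (2 * e' * (L * M) * (v - u))" by (simp add: algebra_simps)
      finally have "(norm (g v))\<^sup>2 - (norm (g u))\<^sup>2 \<le> 2 * e' * (L * M) * (v - u)"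
        using \<open>0 < \<Delta>\<close> by (simp add: mult_le_cancel_left_pos)
      also have "\<dots> \<le> 2 * e' * (L * M + 1) * (v - u)"
        using \<open>0 < e'\<close> uv by (intro mult_right_mono) auto
      also have "2 * e' * (L * M + 1) = e" using LM by (simp add: e'_def field_simps)
      finally show ?thesis by simp
    qed simp
    then show "\<exists>d>0. \<forall>u v. s \<le> u \<longrightarrow> u \<le> v \<longrightarrow> v \<le> t \<longrightarrow> v - u < d \<longrightarrow> (norm (g v))\<^sup>2 \<le> (norm (g u))\<^sup>2 + e * (v - u)"
      using \<open>0 < d\<close> by blast
  qed
  then show ?thesis unfolding g_def by (rule power2_le_imp_le) simp
qed

text \<open>Since \<open>f (y t)\<close> decreases at rate
  \<open>\<tau>' t * (norm (gradf (y t)))\<^sup>2\<close>, this is the decrease of \<open>f\<close>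
  along the trajectory weighted by \<open>\<tau>\<close>.\<close>

definition dissipation :: "real \<Rightarrow> real" where
  "dissipation t = integral {a..t} (\<lambda>r. \<tau> r * \<tau>' r * (norm (gradf (y r)))\<^sup>2)"

lemma dissipation_deriv:
  assumes "a \<le> t"
  shows "(dissipation has_real_derivative \<tau> t * \<tau>' t * (norm (gradf (y t)))\<^sup>2) (at t within {a..})"
  unfolding dissipation_def[abs_def] using assms
  by (intro integral_has_real_derivative_atLeast continuous_intros tau_cont tau'_cont grad_y_cont)

lemma dissipation_mono:
  assumes "a \<le> s" "s \<le> t"
  shows "dissipation s \<le> dissipation t"
proof -
  have "- dissipation t \<le> - dissipation s"
  proof (rule has_real_derivative_nonpos_imp_le[OF DERIV_minus[OF dissipation_deriv]])
    show "- (\<tau> r * \<tau>' r * (norm (gradf (y r)))\<^sup>2) \<le> 0" if "s \<le> r" for r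
      using tau_pos[of r] tau'_pos[of r] that \<open>a \<le> s\<close> by simp
  qed (use assms in auto)
  then show ?thesis by simp
qed

text \<open>\<open>F\<close> is the Lyapunov function plus the dissipation. The terms with
  \<open>\<tau> * \<tau>'\<close> cancel in its derivative, leaving \<open>\<tau>'\<close> times the
  defect in the tangent inequality, which is nonpositive.\<close>

lemma dissipation_le:
  assumes z: "\<forall>x. f z \<le> f x" and "a \<le> t"
  shows "dissipation t \<le> \<tau> a * (f (y a) - f z) + (norm (y a - z))\<^sup>2 / 2"
proof -
  define D where "D t = (norm (y t - z))\<^sup>2 / 2" for t
  define F where "F t = dissipation t + (\<tau> t * (f (y t) - f z) + D t)" for t
  have "F t \<le> F a"
  proof (rule has_real_derivative_nonpos_imp_le[of a F
        "\<lambda>r. \<tau>' r * (f (y r) - f z - inner (gradf (y r)) (y r - z))" a t])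
    show "(F has_real_derivative \<tau>' r * (f (y r) - f z - inner (gradf (y r)) (y r - z))) (at r within {a..})"
      if "a \<le> r" for r
      unfolding F_def[abs_def]
      by (auto intro!: derivative_eq_intros dissipation_deriv[OF that] tau_deriv[OF that] f_y_deriv[OF that]
          dist_deriv[OF that, of z, folded D_def] simp: algebra_simps)
    fix r assume "a \<le> r"
    then show "\<tau>' r * (f (y r) - f z - inner (gradf (y r)) (y r - z)) \<le> 0"
      using tangent_le[of "y r" z] tau'_pos[of r] by (simp add: mult_le_0_iff)
  qed (use \<open>a \<le> t\<close> in auto)
  moreover have "0 \<le> \<tau> t * (f (y t) - f z)" using z tau_pos[OF \<open>a \<le> t\<close>] by simp
  moreover have "dissipation a = 0" by (simp add: dissipation_def)
  moreover have "0 \<le> D t" by (simp add: D_def)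
  ultimately have "dissipation t \<le> \<tau> a * (f (y a) - f z) + D a" by (simp add: F_def)
  then show ?thesis by (simp add: D_def)
qed

text \<open>Fejer monotonicity: at a minimizer \<open>z\<close> the tangent inequality gives
  \<open>inner (gradf (y r)) (y r - z)\<close> a nonnegative sign. Opial's argument and
  \<open>f_gap_le\<close> rest on it.\<close>

lemma norm_dist_antimono:
  assumes z: "\<forall>x. f z \<le> f x" and "a \<le> s" "s \<le> t"
  shows "norm (y t - z) \<le> norm (y s - z)"
proof -
  have "(norm (y t - z))\<^sup>2 / 2 \<le> (norm (y s - z))\<^sup>2 / 2"
  proof (rule has_real_derivative_nonpos_imp_le[of a "\<lambda>t. (norm (y t - z))\<^sup>2 / 2" _ s t, OF dist_deriv])
    fix r assume "s \<le> r"
    then have "0 < \<tau>' r" using tau'_pos[of r] \<open>a \<le> s\<close> by simp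
    moreover have "0 \<le> inner (gradf (y r)) (y r - z)"
      using tangent_le[of "y r" z] z[rule_format, of "y r"] by linarith
    ultimately show "- \<tau>' r * inner (gradf (y r)) (y r - z) \<le> 0" by simp
  qed (use assms in auto)
  then have "(norm (y t - z))\<^sup>2 \<le> (norm (y s - z))\<^sup>2" by simp
  then show ?thesis by (rule power2_le_imp_le) simp
qed

text \<open>On \<open>{s..t}\<close> the gradient norm is at least its value at \<open>t\<close>;
  with this value frozen, the remaining weight \<open>\<tau> * \<tau>'\<close> integrates
  exactly.\<close>

lemma norm_grad_le_dissipation:
  assumes "a \<le> s" "s \<le> t"
  shows "((\<tau> t)\<^sup>2 - (\<tau> s)\<^sup>2) / 2 * (norm (gradf (y t)))\<^sup>2 \<le> dissipation t - dissipation s"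
proof -
  define F where "F r = (\<tau> r)\<^sup>2 / 2 * (norm (gradf (y t)))\<^sup>2 - dissipation r" for r
  have "F t \<le> F s"
  proof (rule has_real_derivative_nonpos_imp_le[of a F
        "\<lambda>r. \<tau> r * \<tau>' r * ((norm (gradf (y t)))\<^sup>2 - (norm (gradf (y r)))\<^sup>2)" s t])
    show "(F has_real_derivative \<tau> r * \<tau>' r * ((norm (gradf (y t)))\<^sup>2 - (norm (gradf (y r)))\<^sup>2)) (at r within {a..})"
      if "a \<le> r" for r
      unfolding F_def[abs_def]
      by (rule DERIV_cong, rule DERIV_diff[OF DERIV_cmult_right[OF DERIV_cdivide[OF DERIV_power[OF tau_deriv]]] dissipation_deriv])
        (use that in \<open>auto simp: algebra_simps\<close>)
    fix r assume "s \<le> r" "r \<le> t"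
    then have "(norm (gradf (y t)))\<^sup>2 \<le> (norm (gradf (y r)))\<^sup>2"
      using norm_grad_antimono[of r t] \<open>a \<le> s\<close> by (intro power_mono) auto
    moreover have "0 \<le> \<tau> r * \<tau>' r" using tau_pos[of r] tau'_pos[of r] \<open>a \<le> s\<close> \<open>s \<le> r\<close> by simp
    ultimately show "\<tau> r * \<tau>' r * ((norm (gradf (y t)))\<^sup>2 - (norm (gradf (y r)))\<^sup>2) \<le> 0"
      by (intro mult_nonneg_nonpos) auto
  qed (use assms in auto)
  then show ?thesis by (simp add: F_def algebra_simps diff_divide_distrib)
qed

text \<open>This is \<open>norm_grad_le_dissipation\<close> from the initial time, with the leftover
  \<open>\<tau> a\<close> term absorbed by monotonicity of the gradient norm.\<close>

lemma tau_norm_grad_bounded: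
  assumes z: "\<forall>x. f z \<le> f x"
  obtains C where "0 < C" "\<And>t. a \<le> t \<Longrightarrow> \<tau> t * norm (gradf (y t)) \<le> C"
proof -
  define E where "E = \<tau> a * (f (y a) - f z) + (norm (y a - z))\<^sup>2 / 2"
  define C2 where "C2 = 2 * E + (\<tau> a * norm (gradf (y a)))\<^sup>2"
  have bound: "(\<tau> t * norm (gradf (y t)))\<^sup>2 \<le> C2" if "a \<le> t" for t
  proof -
    have "((\<tau> t)\<^sup>2 - (\<tau> a)\<^sup>2) / 2 * (norm (gradf (y t)))\<^sup>2 \<le> E"
      using norm_grad_le_dissipation[of a t] dissipation_le[OF z that] that by (simp add: E_def dissipation_def)
    moreover have "(\<tau> a * norm (gradf (y t)))\<^sup>2 \<le> (\<tau> a * norm (gradf (y a)))\<^sup>2"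
      using norm_grad_antimono[of a t] that tau_pos[of a] by (intro power_mono mult_left_mono) auto
    ultimately show ?thesis unfolding C2_def by (simp add: power_mult_distrib algebra_simps)
  qed
  \<comment> \<open>The extra 1 makes the bound strictly positive, so that it can serve as a
    denominator later.\<close>
  have "\<tau> t * norm (gradf (y t)) \<le> sqrt C2 + 1" if "a \<le> t" for t
    using real_le_rsqrt[OF bound[OF that]] by simp
  moreover have "0 \<le> C2" using bound[of a] zero_le_power2 order_trans by blast
  then have "0 < sqrt C2 + 1" by (simp add: add_nonneg_pos)
  ultimately show thesis using that by blast
qed

text \<open>The dissipation is monotone and bounded, so its increments after a late time
  \<open>s\<close> are small. Once \<open>\<tau> t\<close> exceeds \<open>2 * \<tau> s\<close>, the
  subtracted square in \<open>norm_grad_le_dissipation\<close> costs only a constant factor.\<close>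

lemma tau_norm_grad_tendsto_0:
  assumes z: "\<forall>x. f z \<le> f x" and tau_lim: "filterlim \<tau> at_top at_top"
  shows "((\<lambda>t. \<tau> t * norm (gradf (y t))) \<longlongrightarrow> 0) at_top"
proof (rule tendstoI)
  fix e :: real assume "0 < e"
  define E where "E = \<tau> a * (f (y a) - f z) + (norm (y a - z))\<^sup>2 / 2"
  obtain l where l: "((\<lambda>t. E - dissipation t) \<longlongrightarrow> l) at_top" "\<And>t. a \<le> t \<Longrightarrow> l \<le> E - dissipation t"
    by (rule antimono_nonneg_tendsto_at_top[of a "\<lambda>t. E - dissipation t"])
      (use dissipation_mono dissipation_le[OF z] in \<open>auto simp: E_def\<close>)
  have "\<forall>\<^sub>F s in at_top. E - dissipation s < l + e\<^sup>2 / 8 \<and> a \<le> s"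
    using order_tendstoD(2)[OF l(1), of "l + e\<^sup>2 / 8"] \<open>0 < e\<close> eventually_ge_at_top[of a]
    by (simp add: eventually_conj)
  then obtain s where s: "E - dissipation s < l + e\<^sup>2 / 8" "a \<le> s"
    using eventually_happens by fastforce
  have "\<forall>\<^sub>F t in at_top. s \<le> t \<and> 2 * \<tau> s \<le> \<tau> t"
    using eventually_ge_at_top[of s] tau_lim[unfolded filterlim_at_top, rule_format, of "2 * \<tau> s"]
    by (rule eventually_conj)
  then show "\<forall>\<^sub>F t in at_top. dist (\<tau> t * norm (gradf (y t))) 0 < e"
  proof eventually_elim
    case (elim t)
    have "0 < \<tau> s" "0 < \<tau> t" using tau_pos elim s(2) by auto
    have "(2 * \<tau> s)\<^sup>2 \<le> (\<tau> t)\<^sup>2" using elim \<open>0 < \<tau> s\<close> by (intro power_mono) auto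
    then have "4 * (\<tau> s)\<^sup>2 \<le> (\<tau> t)\<^sup>2" by (simp add: power_mult_distrib)
    with zero_le_power2[of "\<tau> t"] have "(\<tau> t)\<^sup>2 / 4 \<le> ((\<tau> t)\<^sup>2 - (\<tau> s)\<^sup>2) / 2"
      by argo
    then have "(\<tau> t)\<^sup>2 / 4 * (norm (gradf (y t)))\<^sup>2 \<le> ((\<tau> t)\<^sup>2 - (\<tau> s)\<^sup>2) / 2 * (norm (gradf (y t)))\<^sup>2"
      by (intro mult_right_mono) auto
    also have "\<dots> \<le> dissipation t - dissipation s" using elim s by (intro norm_grad_le_dissipation) auto
    also have "\<dots> < e\<^sup>2 / 8" using l(2)[of t] s elim by simp
    also have "\<dots> < e\<^sup>2 / 4" using \<open>0 < e\<close> by simp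
    finally have "(\<tau> t * norm (gradf (y t)))\<^sup>2 < e\<^sup>2" by (simp add: power_mult_distrib)
    then show ?case using \<open>0 < e\<close> \<open>0 < \<tau> t\<close> by (auto dest: power_less_imp_less_base)
  qed
qed

text \<open>Transfers any decay rate of the gradient norm to the function values, with the initial
  distance to \<open>z\<close> as constant.\<close>

lemma f_gap_le:
  assumes z: "\<forall>x. f z \<le> f x" and "a \<le> t"
  shows "f (y t) - f z \<le> norm (gradf (y t)) * norm (y a - z)"
proof -
  have "f (y t) - f z \<le> norm (gradf (y t)) * norm (y t - z)"
    using tangent_le norm_cauchy_schwarz order_trans by blast
  also have "\<dots> \<le> norm (gradf (y t)) * norm (y a - z)"
    using norm_dist_antimono[OF z order_refl \<open>a \<le> t\<close>] by (intro mult_left_mono) auto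
  finally show ?thesis .
qed

lemma weakly_converges:
  assumes z0: "\<forall>x. f z0 \<le> f x" and tau_lim: "filterlim \<tau> at_top at_top"
  shows "\<exists>x\<in>{x. \<forall>z. f x \<le> f z}. weakly_converges_at_top y x"
proof (rule weakly_converges_to_minimizer[OF convex])
  show "continuous_on UNIV f"
    using grad by (auto intro!: has_derivative_continuous_on)
  show "bounded (y ` {a..})"
    unfolding bounded_def using norm_dist_antimono[OF z0 order_refl]
    by (auto intro!: exI[of _ z0] exI[of _ "norm (y a - z0)"] simp: dist_norm norm_minus_commute)
  show "\<exists>l. ((\<lambda>t. norm (y t - z)) \<longlongrightarrow> l) at_top" if "\<forall>x. f z \<le> f x" for z
    by (rule antimono_nonneg_tendsto_at_top[of a "\<lambda>t. norm (y t - z)"])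
      (use norm_dist_antimono[OF that] in auto)
  show "\<forall>x. f z0 \<le> f x" by (rule z0)
  have "((\<lambda>t. f (y t) - f z0) \<longlongrightarrow> 0) at_top"
  proof (rule tendsto_sandwich)
    show "\<forall>\<^sub>F t in at_top. 0 \<le> f (y t) - f z0" using z0 by simp
    \<comment> \<open>Once \<open>\<tau> t\<close> is at least 1, inserting this factor only
      enlarges the bound of \<open>f_gap_le\<close>.\<close>
    show "\<forall>\<^sub>F t in at_top. f (y t) - f z0 \<le> (\<tau> t * norm (gradf (y t))) * norm (y a - z0)"
      using eventually_ge_at_top[of a] tau_lim[unfolded filterlim_at_top, rule_format, of 1]
    proof eventually_elim
      case (elim t)
      have "1 * norm (gradf (y t)) \<le> \<tau> t * norm (gradf (y t))" using elim by (intro mult_right_mono) auto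
      then have "norm (gradf (y t)) * norm (y a - z0) \<le> (\<tau> t * norm (gradf (y t))) * norm (y a - z0)"
        by (intro mult_right_mono) auto
      then show ?case using f_gap_le[OF z0] elim by fastforce
    qed
    show "((\<lambda>t. (\<tau> t * norm (gradf (y t))) * norm (y a - z0)) \<longlongrightarrow> 0) at_top"
      using tendsto_mult_right[OF tau_norm_grad_tendsto_0[OF z0 tau_lim], of "norm (y a - z0)"] by simp
  qed simp
  then show "((\<lambda>t. f (y t)) \<longlongrightarrow> f z0) at_top" by (rule Lim_null[THEN iffD2])
qed

end

section \<open>Growth from a differential inequality\<close>

text \<open>The power \<open>u powr (1 / p)\<close> has derivative at least \<open>c / p\<close>,
  hence grows at least linearly.\<close>

lemma powr_lower_bound_of_derivative:
  fixes u u' :: "real \<Rightarrow> real"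
  assumes deriv: "\<And>t. a \<le> t \<Longrightarrow> (u has_real_derivative u' t) (at t within {a..})"
    and pos: "\<And>t. a \<le> t \<Longrightarrow> 0 < u t" and "0 < a" "0 < p" "0 < c"
    and growth: "\<And>t. a \<le> t \<Longrightarrow> c * u t powr (1 - 1 / p) \<le> u' t"
  obtains k where "0 < k" "\<And>t. a \<le> t \<Longrightarrow> (k * t) powr p \<le> u t"
proof -
  \<comment> \<open>The first entry places the line \<open>k * t\<close> below
    \<open>u powr (1 / p)\<close> at \<open>a\<close>; the second keeps its slope below that of the
    power.\<close>
  define k where "k = min (u a powr (1 / p) / a) (c / p)"
  have "0 < k" using pos[of a] \<open>0 < a\<close> \<open>0 < c\<close> \<open>0 < p\<close> by (simp add: k_def)
  moreover have "(k * t) powr p \<le> u t" if "a \<le> t" for t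
  proof -
    define F where "F t = k * t - u t powr (1 / p)" for t
    have "F t \<le> F a"
    proof (rule has_real_derivative_nonpos_imp_le[of a F "\<lambda>r. k - (1 / p) * u r powr (1 / p - 1) * u' r" a t])
      fix r assume "a \<le> r"
      have "((\<lambda>t. u t powr (1 / p)) has_real_derivative (1 / p) * u r powr (1 / p - 1) * u' r) (at r within {a..})"
        using DERIV_chain2[OF has_real_derivative_powr[OF pos[OF \<open>a \<le> r\<close>]] deriv[OF \<open>a \<le> r\<close>]] .
      then show "(F has_real_derivative k - (1 / p) * u r powr (1 / p - 1) * u' r) (at r within {a..})"
        unfolding F_def[abs_def] using DERIV_diff[OF DERIV_cmult_Id] by blast
    next
      fix r assume "a \<le> r"
      have "c / p = (1 / p) * u r powr (1 / p - 1) * (c * u r powr (1 - 1 / p))"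
        using pos[OF \<open>a \<le> r\<close>] by (simp flip: powr_add)
      also have "\<dots> \<le> (1 / p) * u r powr (1 / p - 1) * u' r"
        using growth[OF \<open>a \<le> r\<close>] \<open>0 < p\<close> by (intro mult_left_mono) auto
      finally show "k - (1 / p) * u r powr (1 / p - 1) * u' r \<le> 0" by (simp add: k_def)
    qed (use that in auto)
    moreover have "k * a \<le> u a powr (1 / p)"
      using \<open>0 < a\<close> by (simp add: k_def min_def field_simps)
    ultimately have "k * t \<le> u t powr (1 / p)" by (simp add: F_def)
    then have "(k * t) powr p \<le> (u t powr (1 / p)) powr p"
      using \<open>0 < k\<close> \<open>0 < a\<close> \<open>0 < p\<close> that by (intro powr_mono2) auto
    also have "\<dots> = u t" using pos[OF that] \<open>0 < p\<close> by (simp add: powr_powr)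
    finally show ?thesis .
  qed
  ultimately show thesis by (rule that)
qed

section \<open>The closed-loop system\<close>

text \<open>With \<open>rpow\<close>, the law for \<open>p = 1\<close> reads
  \<open>lam t = 1\<close> even where the gradient vanishes; for \<open>p > 1\<close> it forces a
  nonzero gradient.\<close>

theorem mainTheorem5:
  fixes f :: "'a::{real_inner, complete_space} \<Rightarrow> real"
    and gradf :: "'a \<Rightarrow> 'a"
    and y y' :: "real \<Rightarrow> 'a"
    and lam tau tau' :: "real \<Rightarrow> real"
    and t0 p q :: real
  assumes convex: "convex_on UNIV f"
    and grad: "\<And>x. (f has_derivative (\<lambda>h. inner (gradf x) h)) (at x)"
    and grad_cont: "continuous_on UNIV gradf"
    and argmin_ne: "{x. \<forall>z. f x \<le> f z} \<noteq> {}"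
    and grad_lip: "\<And>B. bounded B \<Longrightarrow> \<exists>L. L-lipschitz_on B gradf"
    and t0: "t0 > 0" and q: "q \<ge> 1/2" and p: "p \<ge> 1"
    and y_deriv: "\<And>t. t \<ge> t0 \<Longrightarrow> (y has_vector_derivative y' t) (at t within {t0..})"
    and y'_cont: "continuous_on {t0..} y'"
    and lam_cont: "continuous_on {t0..} lam"
    and lam_pos: "\<And>t. t \<ge> t0 \<Longrightarrow> lam t > 0"
    and tau_def: "\<And>t. tau t = (1 / q powr q) * (t0 + integral {t0..t} (\<lambda>r. lam r powr (1/q))) powr q"
    and tau_deriv: "\<And>t. t \<ge> t0 \<Longrightarrow> (tau has_real_derivative tau' t) (at t within {t0..})"
    and ode: "\<And>t. t \<ge> t0 \<Longrightarrow> y' t + tau' t *\<^sub>R gradf (y t) = 0"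
    and closed_loop: "\<And>t. t \<ge> t0 \<Longrightarrow> lam t powr p * rpow (norm (gradf (y t))) (p - 1) = 1"
  shows "(\<lambda>t. f (y t) - (INF x. f x)) \<in> o(\<lambda>t. t powr (- (p * q))) \<and>
         (\<lambda>t. norm (gradf (y t))) \<in> o(\<lambda>t. t powr (- (p * q))) \<and>
         (\<lambda>t. t powr (p * q * (2 - 1/q)) * norm (gradf (y t)) powr (2 + (p - 1) / (p * q)))
           integrable_on {t0..} \<and>
         (\<exists>x\<in>{x. \<forall>z. f x \<le> f z}. weakly_converges_at_top y x)"
proof -
  have "0 < q" "0 < p" using q p by auto
  define \<theta> where "\<theta> t = t0 + integral {t0..t} (\<lambda>r. lam r powr (1/q))" for t
  define c where "c = 1 / q powr q"
  have "0 < c" using \<open>0 < q\<close> by (simp add: c_def)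
  have tau_eq: "tau t = c * \<theta> t powr q" for t by (simp add: tau_def \<theta>_def c_def)
  have lam_powr_cont: "continuous_on {t0..} (\<lambda>r. lam r powr (1/q))"
    using lam_pos by (intro continuous_intros lam_cont) force
  have \<theta>_deriv: "(\<theta> has_real_derivative lam t powr (1/q)) (at t within {t0..})" if "t0 \<le> t" for t
    unfolding \<theta>_def[abs_def]
    using DERIV_add[OF DERIV_const integral_has_real_derivative_atLeast[OF lam_powr_cont that]] by simp
  have \<theta>_ge: "t0 \<le> \<theta> t" if "t0 \<le> t" for t
    unfolding \<theta>_def by (simp add: integral_nonneg integrable_continuous_real continuous_on_subset[OF lam_powr_cont])
  then have \<theta>_pos: "0 < \<theta> t" if "t0 \<le> t" for t using t0 that by force
  have \<theta>_cont: "continuous_on {t0..} \<theta>" using \<theta>_deriv by (auto intro!: DERIV_continuous_on)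
  \<comment> \<open>The explicit formula shows the continuity and positivity that the locale
    requires. It agrees with \<open>tau'\<close> by uniqueness of derivatives within
    \<open>{t0..}\<close>, of which each point, \<open>t0\<close> included, is a limit
    point.\<close>
  define T' where "T' t = c * (q * \<theta> t powr (q - 1) * lam t powr (1/q))" for t
  have T'_deriv: "(tau has_real_derivative T' t) (at t within {t0..})" if "t0 \<le> t" for t
  proof -
    have "((\<lambda>t. c * \<theta> t powr q) has_real_derivative T' t) (at t within {t0..})"
      unfolding T'_def
      by (intro DERIV_cmult DERIV_chain2[OF has_real_derivative_powr[OF \<theta>_pos[OF that]] \<theta>_deriv[OF that]])
    then show ?thesis by (simp add: tau_eq[abs_def])
  qed
  have T'_eq: "tau' t = T' t" if "t0 \<le> t" for t
  proof -
    have "t \<in> closure ({t0..} - {t})"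
    proof -
      have "closure {t<..} \<subseteq> closure ({t0..} - {t})" using that by (intro closure_mono) auto
      then show ?thesis by auto
    qed
    then have "at t within {t0..} \<noteq> bot" by (simp add: at_within_eq_bot_iff)
    then show ?thesis
      using vector_derivative_unique_within tau_deriv[OF that] T'_deriv[OF that]
      unfolding has_real_derivative_iff_has_vector_derivative by blast
  qed
  interpret rescaled_gradient_flow f gradf y tau T' t0
  proof unfold_locales
    show "convex_on UNIV f" by (rule convex)
    show "(f has_derivative inner (gradf x)) (at x)" for x by (rule grad)
    show "continuous_on UNIV gradf" by (rule grad_cont)
    show "\<exists>L. L-lipschitz_on B gradf" if "bounded B" for B by (rule grad_lip[OF that])
    show "continuous_on {t0..} T'"
      unfolding T'_def using \<theta>_pos by (intro continuous_intros \<theta>_cont lam_powr_cont) force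
    fix t assume t: "t0 \<le> t"
    have "y' t = - T' t *\<^sub>R gradf (y t)" using ode[OF t] T'_eq[OF t] by (simp add: eq_neg_iff_add_eq_0)
    then show "(y has_vector_derivative - T' t *\<^sub>R gradf (y t)) (at t within {t0..})"
      using y_deriv[OF t] by simp
    show "(tau has_real_derivative T' t) (at t within {t0..})" by (rule T'_deriv[OF t])
    show "0 < T' t" using \<open>0 < c\<close> \<open>0 < q\<close> \<theta>_pos[OF t] lam_pos[OF t] by (simp add: T'_def)
    show "0 < tau t" using \<open>0 < c\<close> \<theta>_pos[OF t] by (simp add: tau_eq)
  qed
  obtain z where z: "\<forall>x. f z \<le> f x" using argmin_ne by blast
  obtain C where C: "0 < C" "\<And>t. t0 \<le> t \<Longrightarrow> tau t * norm (gradf (y t)) \<le> C"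
    using tau_norm_grad_bounded[OF z] by blast
  \<comment> \<open>The law and the bound \<open>C\<close> give \<open>lam powr p\<close> at least
    \<open>(tau / C) powr (p - 1)\<close>. Raising to the power \<open>1 / (p * q)\<close> and
    inserting \<open>tau = c * \<theta> powr q\<close> produces this constant and a differential
    inequality for \<theta>.\<close>
  define b where "b = (c / C) powr ((p - 1) / (p * q))"
  have "0 < b" using \<open>0 < c\<close> C(1) by (simp add: b_def)
  have lam_lower: "b * \<theta> t powr (1 - 1 / p) \<le> lam t powr (1/q)" if t: "t0 \<le> t" for t
  proof -
    have "norm (gradf (y t)) \<le> C / tau t"
      using C(2)[OF t] tau_pos[OF t] by (simp add: field_simps)
    then have "rpow (norm (gradf (y t))) (p - 1) \<le> (C / tau t) powr (p - 1)"
      using p C(1) tau_pos[OF t] by (auto simp: rpow_def intro: powr_mono2)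
    then have "1 \<le> lam t powr p * (C / tau t) powr (p - 1)"
      using closed_loop[OF t] mult_left_mono[of _ _ "lam t powr p"] by fastforce
    then have "(tau t / C) powr (p - 1) \<le> lam t powr p"
      using C(1) tau_pos[OF t] by (simp add: powr_divide field_simps)
    then have "((tau t / C) powr (p - 1)) powr (1 / (p * q)) \<le> (lam t powr p) powr (1 / (p * q))"
      using \<open>0 < p\<close> \<open>0 < q\<close> by (intro powr_mono2) auto
    also have "\<dots> = lam t powr (1/q)" using \<open>0 < p\<close> by (simp add: powr_powr)
    also have "((tau t / C) powr (p - 1)) powr (1 / (p * q)) = (c / C) powr ((p - 1) / (p * q)) * \<theta> t powr (q * ((p - 1) / (p * q)))"
      using \<open>0 < c\<close> C(1) \<theta>_pos[OF t] by (simp add: powr_powr tau_eq powr_mult powr_divide)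
    also have "q * ((p - 1) / (p * q)) = 1 - 1 / p" using \<open>0 < p\<close> \<open>0 < q\<close> by (simp add: field_simps)
    finally show ?thesis by (simp add: b_def)
  qed
  obtain k where k: "0 < k" "\<And>t. t0 \<le> t \<Longrightarrow> (k * t) powr p \<le> \<theta> t"
    using powr_lower_bound_of_derivative[of t0 \<theta> "\<lambda>t. lam t powr (1/q)" p b] \<theta>_deriv \<theta>_pos t0 \<open>0 < p\<close> \<open>0 < b\<close> lam_lower
    by blast
  \<comment> \<open>The growth \<open>(k * t) powr p\<close> of \<theta> raised to the power
    \<open>q\<close>, times \<open>c\<close>: the time scale dominates
    \<open>t powr (p * q)\<close>.\<close>
  define K where "K = c * k powr (p * q)"
  have "0 < K" using \<open>0 < c\<close> k(1) by (simp add: K_def)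
  have tau_lower: "K * t powr (p * q) \<le> tau t" if t: "t0 \<le> t" for t
  proof -
    have "((k * t) powr p) powr q \<le> \<theta> t powr q" using k(2)[OF t] \<open>0 < q\<close> by (intro powr_mono2) auto
    then show ?thesis
      using \<open>0 < c\<close> k(1) t t0 by (simp add: tau_eq K_def powr_powr powr_mult mult.assoc)
  qed
  have tau_lim: "filterlim tau at_top at_top"
  proof (rule filterlim_at_top_mono)
    have "filterlim (\<lambda>t::real. t powr (p * q)) at_top at_top"
      using \<open>0 < p\<close> \<open>0 < q\<close> by (intro real_powr_at_top) auto
    then show "filterlim (\<lambda>t. K * t powr (p * q)) at_top at_top"
      using \<open>0 < K\<close> filterlim_tendsto_pos_mult_at_top[OF tendsto_const] by blast
    show "\<forall>\<^sub>F t in at_top. K * t powr (p * q) \<le> tau t"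
      using eventually_ge_at_top[of t0] tau_lower by (rule eventually_mono)
  qed
  have grad_o: "(\<lambda>t. norm (gradf (y t))) \<in> o(\<lambda>t. t powr (- (p * q)))"
  proof (rule landau_o.smallI)
    fix e :: real assume "0 < e"
    have "\<forall>\<^sub>F t in at_top. tau t * norm (gradf (y t)) < K * e"
      using order_tendstoD(2)[OF tau_norm_grad_tendsto_0[OF z tau_lim], of "K * e"] \<open>0 < e\<close> \<open>0 < K\<close> by simp
    then show "\<forall>\<^sub>F t in at_top. norm (norm (gradf (y t))) \<le> e * norm (t powr (- (p * q)))"
      using eventually_ge_at_top[of t0]
    proof eventually_elim
      case (elim t)
      have "K * t powr (p * q) * norm (gradf (y t)) \<le> tau t * norm (gradf (y t))"
        using tau_lower elim by (intro mult_right_mono) auto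
      then have "K * (t powr (p * q) * norm (gradf (y t))) \<le> K * e" using elim by simp
      then have "t powr (p * q) * norm (gradf (y t)) \<le> e" using \<open>0 < K\<close> by simp
      then show ?case using elim t0 by (simp add: powr_minus field_simps)
    qed
  qed
  have INF_eq: "(INF x. f x) = f z"
    using z by (intro cInf_eq_minimum) auto
  have "(\<lambda>t. f (y t) - (INF x. f x)) \<in> O(\<lambda>t. norm (gradf (y t)))"
  proof (rule bigoI[of _ "norm (y t0 - z)"])
    show "\<forall>\<^sub>F t in at_top. norm (f (y t) - (INF x. f x)) \<le> norm (y t0 - z) * norm (norm (gradf (y t)))"
      using eventually_ge_at_top[of t0]
    proof eventually_elim
      case (elim t)
      then show ?case using f_gap_le[OF z elim] z by (simp add: INF_eq mult.commute)
    qed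
  qed
  then have f_o: "(\<lambda>t. f (y t) - (INF x. f x)) \<in> o(\<lambda>t. t powr (- (p * q)))"
    using grad_o by (rule landau_o.big_small_trans)
  define h where "h t = t powr (p * q * (2 - 1/q)) * norm (gradf (y t)) powr (2 + (p - 1) / (p * q))" for t
  \<comment> \<open>\<open>G\<close> bounds the surplus power of the gradient norm beyond 2, which
    is largest at \<open>t0\<close>. \<open>A\<close> collects the constants in a lower bound for
    \<open>tau * T'\<close>, so that the integrand \<open>h\<close> is dominated by that of
    \<open>dissipation\<close>.\<close>
  define G where "G = norm (gradf (y t0)) powr ((p - 1) / (p * q))"
  define A where "A = c * c * q * k powr (p * (2 * q - 1)) * (b * t0 powr (1 - 1 / p))"
  have "0 < A" using \<open>0 < c\<close> \<open>0 < q\<close> k(1) \<open>0 < b\<close> t0 by (simp add: A_def)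
  have h_le: "h t \<le> G / A * (tau t * T' t * (norm (gradf (y t)))\<^sup>2)" if t: "t0 \<le> t" for t
  proof -
    have "A * t powr (p * (2 * q - 1)) = c * c * q * (k * t) powr (p * (2 * q - 1)) * (b * t0 powr (1 - 1 / p))"
      using k(1) t t0 by (simp add: A_def powr_mult)
    also have "\<dots> = c * c * q * ((k * t) powr p) powr (2 * q - 1) * (b * t0 powr (1 - 1 / p))"
      by (simp add: powr_powr)
    also have "\<dots> \<le> c * c * q * \<theta> t powr (2 * q - 1) * lam t powr (1/q)"
    proof (intro mult_mono)
      \<comment> \<open>Here \<open>q \<ge> 1/2\<close> enters: it makes the exponent
        \<open>2 * q - 1\<close> nonnegative.\<close>
      show "((k * t) powr p) powr (2 * q - 1) \<le> \<theta> t powr (2 * q - 1)"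
        using k(2)[OF t] q by (intro powr_mono2) auto
      \<comment> \<open>Replacing \<theta> by its least value \<open>t0\<close> bounds
        \<open>lam powr (1/q)\<close> below by a positive constant.\<close>
      have "b * t0 powr (1 - 1 / p) \<le> b * \<theta> t powr (1 - 1 / p)"
        using \<theta>_ge[OF t] t0 p \<open>0 < b\<close> by (intro mult_left_mono powr_mono2) auto
      then show "b * t0 powr (1 - 1 / p) \<le> lam t powr (1/q)" using lam_lower[OF t] by simp
    qed (use \<open>0 < c\<close> \<open>0 < q\<close> \<open>0 < b\<close> in auto)
    also have "\<dots> = tau t * T' t"
      using \<theta>_pos[OF t] by (simp add: tau_eq T'_def mult_ac flip: powr_add)
    finally have "A * t powr (p * (2 * q - 1)) \<le> tau t * T' t" .
    then have "t powr (p * (2 * q - 1)) \<le> (tau t * T' t) / A"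
      using \<open>0 < A\<close> by (simp add: field_simps)
    moreover have "norm (gradf (y t)) powr ((p - 1) / (p * q)) \<le> G"
      unfolding G_def using norm_grad_antimono[OF order_refl t] p \<open>0 < q\<close> by (intro powr_mono2) auto
    moreover have "norm (gradf (y t)) powr (2 + (p - 1) / (p * q))
        = (norm (gradf (y t)))\<^sup>2 * norm (gradf (y t)) powr ((p - 1) / (p * q))"
      by (simp add: powr_add powr_numeral)
    moreover have "p * q * (2 - 1/q) = p * (2 * q - 1)" using \<open>0 < q\<close> by (simp add: field_simps)
    ultimately have "h t \<le> (tau t * T' t) / A * ((norm (gradf (y t)))\<^sup>2 * G)"
      unfolding h_def using \<open>0 < A\<close> tau_pos[OF t] tau'_pos[OF t]
      by (simp only:) (intro mult_mono mult_left_mono, auto)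
    then show ?thesis by (simp add: mult_ac)
  qed
  have h_cont: "continuous_on {t0..} h"
  proof -
    \<comment> \<open>A strictly positive exponent makes the power continuous also where the
      gradient vanishes.\<close>
    have "0 < 2 + (p - 1) / (p * q)" using p \<open>0 < q\<close> by (intro add_pos_nonneg) auto
    then show ?thesis
      unfolding h_def using t0
      by (intro continuous_on_mult continuous_on_powr' continuous_intros grad_y_cont) auto
  qed
  have "h integrable_on {t0..}"
  proof (rule integrable_on_atLeast_of_bounded[OF h_cont])
    show "0 \<le> h t" for t by (simp add: h_def)
    fix t assume t: "t0 \<le> t"
    have sub: "{t0..t} \<subseteq> {t0..}" by auto
    have "integral {t0..t} h \<le> integral {t0..t} (\<lambda>t. G / A * (tau t * T' t * (norm (gradf (y t)))\<^sup>2))"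
      by (intro integral_le integrable_continuous_real continuous_on_subset[OF h_cont sub]
          continuous_on_subset[OF _ sub] continuous_intros tau_cont tau'_cont grad_y_cont h_le) auto
    also have "\<dots> = G / A * dissipation t" by (simp add: dissipation_def)
    also have "\<dots> \<le> G / A * (tau t0 * (f (y t0) - f z) + (norm (y t0 - z))\<^sup>2 / 2)"
      using dissipation_le[OF z t] \<open>0 < A\<close> by (intro mult_left_mono) (auto simp: G_def)
    finally show "integral {t0..t} h \<le> G / A * (tau t0 * (f (y t0) - f z) + (norm (y t0 - z))\<^sup>2 / 2)" .
  qed
  then show ?thesis
    using f_o grad_o weakly_converges[OF z tau_lim] by (auto simp: h_def[abs_def])
qed

end
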